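(* Let $\Omega$ be a commutative semigroup and let $(A,(\prec_\omega,\succ_\omega)_{\omega\in\Omega})$ be a dendriform family algebra. For $\omega\in\Omega$ define binary operations on $A$ by $$x\rhd_\omega y:=x\succ_\omega y-y\prec_\omega x .$$ Then $(A,(\rhd_\omega)_{\omega\in\Omega})$ is a (left) pre-Lie family algebra.
   Context: $\mathbf{k}$ is a unitary commutative ring; all modules and (multi)linear maps are over $\mathbf{k}$, and all binary operations are $\mathbf{k}$-bilinear. Dendriform family algebra (over a semigroup $\Omega$): a $\mathbf{k}$-module $D$ with a family of bilinear operations $(\prec_\omega,\succ_\omega)_{\omega\in\Omega}$ such that for all $x,y,z\in D$ and $\alpha,\beta\in\Omega$: $(x\prec_{\alpha} y) \prec_{\beta} z= x \prec_{\alpha \beta} (y\prec_{\beta} z+y \succ_{\alpha} z)$; $(x\succ_{\alpha} y)\prec_{\beta} z= x\succ_{\alpha} (y\prec_{\beta} z)$; $(x\prec_{\beta} y+x\succ_{\alpha} y) \succ_{\alpha \beta}z = x\succ_{\alpha}(y \succ_{\beta} z)$. (Left) pre-Lie family algebra (over a commutative semigroup $\Omega$): a $\mathbf{k}$-module $A$ with bilinear operations $\rhd_\omega:A\times A\to A$, $\omega\in\Omega$, such that for all $x,y,z\in A$ and $\alpha,\beta\in\Omega$: $x\rhd_\alpha(y\rhd_\beta z)-(x\rhd_\alpha y)\rhd_{\alpha\beta}z=y\rhd_\beta(x\rhd_\alpha z)-(y\rhd_\beta x)\rhd_{\beta\alpha}z$. *)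

theory Defs
  imports "HOL-Algebra.Module"
begin

definition bilinear_op ::
  "('k, 'm) ring_scheme \<Rightarrow> ('k, 'a, 'n) module_scheme \<Rightarrow> ('a \<Rightarrow> 'a \<Rightarrow> 'a) \<Rightarrow> bool"
where
  "bilinear_op R M f \<longleftrightarrow>
     (\<forall>x \<in> carrier M. \<forall>y \<in> carrier M. f x y \<in> carrier M) \<and>
     (\<forall>x \<in> carrier M. \<forall>x' \<in> carrier M. \<forall>y \<in> carrier M.
        f (x \<oplus>\<^bsub>M\<^esub> x') y = f x y \<oplus>\<^bsub>M\<^esub> f x' y) \<and>
     (\<forall>x \<in> carrier M. \<forall>y \<in> carrier M. \<forall>y' \<in> carrier M.
        f x (y \<oplus>\<^bsub>M\<^esub> y') = f x y \<oplus>\<^bsub>M\<^esub> f x y') \<and>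
     (\<forall>c \<in> carrier R. \<forall>x \<in> carrier M. \<forall>y \<in> carrier M.
        f (c \<odot>\<^bsub>M\<^esub> x) y = c \<odot>\<^bsub>M\<^esub> f x y \<and>
        f x (c \<odot>\<^bsub>M\<^esub> y) = c \<odot>\<^bsub>M\<^esub> f x y)"

(* The index semigroup is a type of class semigroup_mult.  A family of operations takes its
   index first: prec \<alpha> x y and succ \<alpha> x y stand for the infix x \<prec> y and
   x \<succ> y with subscript \<alpha>, and rhd \<alpha> x y below for x \<rhd> y with
   subscript \<alpha>. *)
locale dendriform_family_algebra = Module.module R D
  for R :: "('k, 'm) ring_scheme" (structure)
    and D :: "('k, 'a, 'n) module_scheme" (structure) +
  fixes prec succ :: "'w::semigroup_mult \<Rightarrow> 'a \<Rightarrow> 'a \<Rightarrow> 'a"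
  assumes prec_bilinear: "bilinear_op R D (prec \<alpha>)"
    and succ_bilinear: "bilinear_op R D (succ \<alpha>)"
    and prec_prec:
      "\<lbrakk>x \<in> carrier D; y \<in> carrier D; z \<in> carrier D\<rbrakk> \<Longrightarrow>
       prec \<beta> (prec \<alpha> x y) z = prec (\<alpha> * \<beta>) x (prec \<beta> y z \<oplus>\<^bsub>D\<^esub> succ \<alpha> y z)"
    and succ_prec:
      "\<lbrakk>x \<in> carrier D; y \<in> carrier D; z \<in> carrier D\<rbrakk> \<Longrightarrow>
       prec \<beta> (succ \<alpha> x y) z = succ \<alpha> x (prec \<beta> y z)"
    and succ_succ:
      "\<lbrakk>x \<in> carrier D; y \<in> carrier D; z \<in> carrier D\<rbrakk> \<Longrightarrow>
       succ (\<alpha> * \<beta>) (prec \<beta> x y \<oplus>\<^bsub>D\<^esub> succ \<alpha> x y) z = succ \<alpha> x (succ \<beta> y z)"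

locale pre_lie_family_algebra = Module.module R A
  for R :: "('k, 'm) ring_scheme" (structure)
    and A :: "('k, 'a, 'n) module_scheme" (structure) +
  fixes rhd :: "'w::ab_semigroup_mult \<Rightarrow> 'a \<Rightarrow> 'a \<Rightarrow> 'a"
  assumes rhd_bilinear: "bilinear_op R A (rhd \<alpha>)"
    and pre_lie:
      "\<lbrakk>x \<in> carrier A; y \<in> carrier A; z \<in> carrier A\<rbrakk> \<Longrightarrow>
       rhd \<alpha> x (rhd \<beta> y z) \<ominus>\<^bsub>A\<^esub> rhd (\<alpha> * \<beta>) (rhd \<alpha> x y) z =
       rhd \<beta> y (rhd \<alpha> x z) \<ominus>\<^bsub>A\<^esub> rhd (\<beta> * \<alpha>) (rhd \<beta> y x) z"

end

theory Submission
  imports Defs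
begin

text \<open>Expand \<open>x \<rhd>\<^sub>\<alpha> (y \<rhd>\<^sub>\<beta> z) - (x \<rhd>\<^sub>\<alpha> y) \<rhd>\<^sub>\<alpha>\<^sub>\<beta> z\<close> into eight terms. The dendriform axioms, together with
  commutativity of the index semigroup, cancel \<open>(x \<succ>\<^sub>\<alpha> y) \<succ>\<^sub>\<alpha>\<^sub>\<beta> z\<close> and \<open>z \<prec>\<^sub>\<alpha>\<^sub>\<beta> (y \<prec>\<^sub>\<alpha> x)\<close>, and what remains
  is invariant under exchanging \<open>(x, \<alpha>)\<close> with \<open>(y, \<beta>)\<close>.\<close>

lemma (in abelian_group) minus_eqI:
  assumes "x \<in> carrier G" "y \<in> carrier G" "z \<in> carrier G" "z \<oplus> y = x"
  shows "z = x \<ominus> y"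
  using assms by (auto simp: a_minus_def a_assoc r_neg)

lemma (in abelian_group) minus_add_minus:
  assumes "a \<in> carrier G" "b \<in> carrier G" "c \<in> carrier G" "d \<in> carrier G"
  shows "(a \<oplus> b) \<ominus> (c \<oplus> d) = (a \<ominus> c) \<oplus> (b \<ominus> d)"
  using assms by (simp add: a_minus_def minus_add a_ac)

lemma (in module) bilinear_op_closed:
  "\<lbrakk>bilinear_op R M f; x \<in> carrier M; y \<in> carrier M\<rbrakk> \<Longrightarrow> f x y \<in> carrier M"
  by (simp add: bilinear_op_def)

lemma (in module) bilinear_op_add_left:
  "\<lbrakk>bilinear_op R M f; x \<in> carrier M; x' \<in> carrier M; y \<in> carrier M\<rbrakk> \<Longrightarrow>
   f (x \<oplus>\<^bsub>M\<^esub> x') y = f x y \<oplus>\<^bsub>M\<^esub> f x' y"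
  by (simp add: bilinear_op_def)

lemma (in module) bilinear_op_add_right:
  "\<lbrakk>bilinear_op R M f; x \<in> carrier M; y \<in> carrier M; y' \<in> carrier M\<rbrakk> \<Longrightarrow>
   f x (y \<oplus>\<^bsub>M\<^esub> y') = f x y \<oplus>\<^bsub>M\<^esub> f x y'"
  by (simp add: bilinear_op_def)

text \<open>Additivity applied to (x - x') + x' = x; \<open>minus_eqI\<close> turns the resulting
  sum into a difference.\<close>

lemma (in module) bilinear_op_minus_left:
  assumes f: "bilinear_op R M f" and x: "x \<in> carrier M" "x' \<in> carrier M" "y \<in> carrier M"
  shows "f (x \<ominus>\<^bsub>M\<^esub> x') y = f x y \<ominus>\<^bsub>M\<^esub> f x' y"
proof (rule M.minus_eqI)
  have "x \<ominus>\<^bsub>M\<^esub> x' \<oplus>\<^bsub>M\<^esub> x' = x"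
    using x by (simp add: M.a_assoc M.l_neg a_minus_def)
  then show "f (x \<ominus>\<^bsub>M\<^esub> x') y \<oplus>\<^bsub>M\<^esub> f x' y = f x y"
    using x by (simp flip: bilinear_op_add_left[OF f])
qed (use f x in \<open>auto intro: bilinear_op_closed\<close>)

lemma (in module) bilinear_op_minus_right:
  assumes f: "bilinear_op R M f" and x: "x \<in> carrier M" "y \<in> carrier M" "y' \<in> carrier M"
  shows "f x (y \<ominus>\<^bsub>M\<^esub> y') = f x y \<ominus>\<^bsub>M\<^esub> f x y'"
proof (rule M.minus_eqI)
  have "y \<ominus>\<^bsub>M\<^esub> y' \<oplus>\<^bsub>M\<^esub> y' = y"
    using x by (simp add: M.a_assoc M.l_neg a_minus_def)
  then show "f x (y \<ominus>\<^bsub>M\<^esub> y') \<oplus>\<^bsub>M\<^esub> f x y' = f x y"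
    using x by (simp flip: bilinear_op_add_right[OF f])
qed (use f x in \<open>auto intro: bilinear_op_closed\<close>)

text \<open>With \<open>succ \<alpha>\<close> for \<open>f\<close> and \<open>prec \<alpha>\<close>
  for \<open>g\<close>, this gives bilinearity of the pre-Lie operations.\<close>

lemma (in module) bilinear_op_diff_flip:
  assumes f: "bilinear_op R M f" and g: "bilinear_op R M g"
  shows "bilinear_op R M (\<lambda>x y. f x y \<ominus>\<^bsub>M\<^esub> g y x)"
  using f g unfolding bilinear_op_def
  by (simp add: M.minus_add_minus smult_r_distr smult_r_minus a_minus_def M.minus_closed M.minus_add M.a_ac)

text \<open>The additive skeleton of the expansion: the \<open>s\<close> and \<open>p\<close> stand
  for terms whose outer operation is \<open>succ (\<alpha> * \<beta>)\<close> and
  \<open>prec (\<alpha> * \<beta>)\<close>, and \<open>a\<close>, \<open>b\<close> for the mixed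
  terms. The shared \<open>s2\<close> and \<open>p1\<close> drop out.\<close>

lemma (in abelian_group) diff_diff_cancel_common:
  assumes "s1 \<in> carrier G" "s2 \<in> carrier G" "s3 \<in> carrier G" "a \<in> carrier G" "b \<in> carrier G"
    "p1 \<in> carrier G" "p2 \<in> carrier G" "p3 \<in> carrier G"
  shows "((s1 \<oplus> s2) \<ominus> a) \<ominus> (b \<ominus> (p1 \<oplus> p2)) \<ominus> ((s2 \<ominus> s3) \<ominus> (p3 \<ominus> p1))
    = (s1 \<oplus> s3) \<ominus> (a \<oplus> b) \<oplus> (p2 \<oplus> p3)"
proof -
  \<comment> \<open>Sorting both sides modulo AC does not cancel anything, so the right-hand side
    keeps each vanishing pair explicit.\<close>
  have "((s1 \<oplus> s2) \<ominus> a) \<ominus> (b \<ominus> (p1 \<oplus> p2)) \<ominus> ((s2 \<ominus> s3) \<ominus> (p3 \<ominus> p1))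
    = (s2 \<oplus> \<ominus> s2) \<oplus> ((p1 \<oplus> \<ominus> p1) \<oplus> ((s1 \<oplus> s3) \<ominus> (a \<oplus> b) \<oplus> (p2 \<oplus> p3)))"
    using assms by (simp only: a_minus_def minus_add a_ac add.inv_closed minus_minus a_closed)
  then show ?thesis
    using assms by (simp add: r_neg)
qed

context dendriform_family_algebra
begin

text \<open>Each of the three bracketed sums is an orbit of the exchange of (x, \<alpha>) and (y,
  \<beta>). Indices in this locale form an arbitrary semigroup, so \<open>comm\<close> is assumed
  for the two at hand.\<close>

lemma associator_normal_form:
  fixes \<alpha> \<beta> :: 'w
  defines "rhd \<equiv> \<lambda>\<omega> x y. succ \<omega> x y \<ominus>\<^bsub>D\<^esub> prec \<omega> y x"
  assumes xyz: "x \<in> carrier D" "y \<in> carrier D" "z \<in> carrier D" and comm: "\<beta> * \<alpha> = \<alpha> * \<beta>"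
  shows "rhd \<alpha> x (rhd \<beta> y z) \<ominus>\<^bsub>D\<^esub> rhd (\<alpha> * \<beta>) (rhd \<alpha> x y) z =
    (succ (\<alpha> * \<beta>) (prec \<beta> x y) z \<oplus>\<^bsub>D\<^esub> succ (\<alpha> * \<beta>) (prec \<alpha> y x) z)
    \<ominus>\<^bsub>D\<^esub> (succ \<alpha> x (prec \<beta> z y) \<oplus>\<^bsub>D\<^esub> succ \<beta> y (prec \<alpha> z x))
    \<oplus>\<^bsub>D\<^esub> (prec (\<alpha> * \<beta>) z (succ \<beta> y x) \<oplus>\<^bsub>D\<^esub> prec (\<alpha> * \<beta>) z (succ \<alpha> x y))"
proof -
  note bil = prec_bilinear succ_bilinear
  note closed = bil[THEN bilinear_op_closed]
  have 1: "succ \<alpha> x (succ \<beta> y z)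
      = succ (\<alpha> * \<beta>) (prec \<beta> x y) z \<oplus>\<^bsub>D\<^esub> succ (\<alpha> * \<beta>) (succ \<alpha> x y) z"
    using xyz by (simp add: closed bilinear_op_add_left[OF succ_bilinear] flip: succ_succ)
  \<comment> \<open>\<open>prec_prec\<close> produces the index \<open>\<beta> * \<alpha>\<close>;
    \<open>comm\<close> makes the first summand equal to one from the expansion of
    \<open>rhd (\<alpha> * \<beta>) (rhd \<alpha> x y) z\<close>.\<close>
  have 2: "prec \<alpha> (prec \<beta> z y) x
      = prec (\<alpha> * \<beta>) z (prec \<alpha> y x) \<oplus>\<^bsub>D\<^esub> prec (\<alpha> * \<beta>) z (succ \<beta> y x)"
    using xyz by (simp add: closed prec_prec comm bilinear_op_add_right[OF prec_bilinear])
  show ?thesis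
    unfolding rhd_def
    using xyz
    \<comment> \<open>\<open>succ_prec\<close> rewrites
      \<open>prec \<alpha> (succ \<beta> y z) x\<close> to
      \<open>succ \<beta> y (prec \<alpha> z x)\<close>, the mirror image of the other mixed
      term.\<close>
    by (simp add: closed bil[THEN bilinear_op_minus_left] bil[THEN bilinear_op_minus_right]
        1 2 succ_prec M.diff_diff_cancel_common)
qed

end

theorem theorem2p4:
  fixes R :: "('k, 'm) ring_scheme"
    and A :: "('k, 'a, 'n) module_scheme"
    and prec succ :: "'w::ab_semigroup_mult \<Rightarrow> 'a \<Rightarrow> 'a \<Rightarrow> 'a"
  assumes "dendriform_family_algebra R A prec succ"
  shows "pre_lie_family_algebra R A (\<lambda>\<omega> x y. succ \<omega> x y \<ominus>\<^bsub>A\<^esub> prec \<omega> y x)"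
proof -
  interpret dendriform_family_algebra R A prec succ by fact
  note closed = prec_bilinear[THEN bilinear_op_closed] succ_bilinear[THEN bilinear_op_closed]
  show ?thesis
  proof unfold_locales
    show "bilinear_op R A (\<lambda>x y. succ \<alpha> x y \<ominus>\<^bsub>A\<^esub> prec \<alpha> y x)" for \<alpha>
      by (rule bilinear_op_diff_flip[OF succ_bilinear prec_bilinear])
  next
    fix x y z \<alpha> \<beta>
    assume "x \<in> carrier A" "y \<in> carrier A" "z \<in> carrier A"
    then show "succ \<alpha> x (succ \<beta> y z \<ominus>\<^bsub>A\<^esub> prec \<beta> z y) \<ominus>\<^bsub>A\<^esub> prec \<alpha> (succ \<beta> y z \<ominus>\<^bsub>A\<^esub> prec \<beta> z y) x
        \<ominus>\<^bsub>A\<^esub> (succ (\<alpha> * \<beta>) (succ \<alpha> x y \<ominus>\<^bsub>A\<^esub> prec \<alpha> y x) z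
          \<ominus>\<^bsub>A\<^esub> prec (\<alpha> * \<beta>) z (succ \<alpha> x y \<ominus>\<^bsub>A\<^esub> prec \<alpha> y x))
      = succ \<beta> y (succ \<alpha> x z \<ominus>\<^bsub>A\<^esub> prec \<alpha> z x) \<ominus>\<^bsub>A\<^esub> prec \<beta> (succ \<alpha> x z \<ominus>\<^bsub>A\<^esub> prec \<alpha> z x) y
        \<ominus>\<^bsub>A\<^esub> (succ (\<beta> * \<alpha>) (succ \<beta> y x \<ominus>\<^bsub>A\<^esub> prec \<beta> x y) z
          \<ominus>\<^bsub>A\<^esub> prec (\<beta> * \<alpha>) z (succ \<beta> y x \<ominus>\<^bsub>A\<^esub> prec \<beta> x y))"
      \<comment> \<open>The normal form applies to both sides, to the right one with the roles
        exchanged; the summands then differ only in order and in \<open>\<alpha> * \<beta>\<close>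
        against \<open>\<beta> * \<alpha>\<close>.\<close>
      by (simp only: associator_normal_form[OF _ _ _ mult.commute])
        (simp add: mult.commute closed M.a_comm)
  qed
qed

end
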